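(* Let $k,d,t\in\mathbb N_+$ with $k\ge4$, $2\le t\le k-2$ and $2t\le d+1$, and set $n=k+d$. Decompose $n-(k-1)=ct+r$ with $c,r\in\mathbb N$ such that $0\le r<t$. Then $c\ge2$, and with $\kappa=c+1$ the partitions $$p=\big((\kappa+1)^{[r]},\kappa^{[t-r]},1^{[k-1-t]}\big),\qquad q=\big(d+1,1^{[k-1]}\big)$$ satisfy: $p\in\mathcal J(\mathcal L_n)$ is of type D, $q\in\mathcal M(\mathcal L_n)$ is of type III, and $p\nearrow q$ holds but $p\swarrow q$ does not hold.
   Context: $\mathbb N=\{0,1,2,\dots\}$, $\mathbb N_+=\mathbb N\setminus\{0\}$. A partition of $n\in\mathbb N$ is a tuple $(a_1,\dots,a_n)$ of natural numbers with $a_1\ge\dots\ge a_n\ge 0$ and $\sum a_i=n$; trailing zeros may be omitted or added. $x^{[s]}$ denotes $s$ consecutive entries equal to $x$ (no entry if $s=0$). $\mathcal L_n$ is the finite lattice of all partitions of $n$ under the dominance order: $a\le b$ iff $\sum_{i=1}^j a_i\le\sum_{i=1}^j b_i$ for all $1\le j\le n$. $\mathcal J(\mathcal L_n)$ is the set of (completely) join-irreducible elements (not the least element, and $x=y\vee z$ implies $x=y$ or $x=z$); $\mathcal M(\mathcal L_n)$ is the set of (completely) meet-irreducible elements (not the greatest element, and $x=y\wedge z$ implies $x=y$ or $x=z$). Arrow relations of the standard context $(\mathcal J(\mathcal L_n),\mathcal M(\mathcal L_n),\le)$: for $g\in\mathcal J(\mathcal L_n)$ and $m\in\mathcal M(\mathcal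 L_n)$ put $g'=\{y\in\mathcal M(\mathcal L_n): g\le y\}$ and $m'=\{y\in\mathcal J(\mathcal L_n): y\le m\}$. Then $g\swarrow m$ iff $g\nleq m$ and for all $h\in\mathcal J(\mathcal L_n)$ with $g'\subsetneq h'$ we have $h\le m$; and $g\nearrow m$ iff $g\nleq m$ and for all $y\in\mathcal M(\mathcal L_n)$ with $m'\subsetneq y'$ we have $g\le y$. Types of partitions of $n$: type D (in $\mathcal J(\mathcal L_n)$): $((k+1)^{[b]},k^{[\ell]},1^{[d]})$ with $b\in\mathbb N$, $\ell,d\in\mathbb N_+$, $k\ge3$, $b+\ell\ge2$; type III (in $\mathcal M(\mathcal L_n)$): $(a,1^{[c]})$ with $a\ge2$, $c\ge2$. *)

theory Defs
  imports "HOL-Algebra.Complete_Lattice"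
begin

section \<open>The dominance lattice of partitions of \<open>n\<close>\<close>

text \<open>A partition of \<open>n\<close> is a list of length exactly \<open>n\<close>, including trailing zeros, so that
  equality of partitions is equality of lists. List positions are counted from 0.\<close>

definition partitions :: "nat \<Rightarrow> nat list set" where
  "partitions n = {a. length a = n \<and> sorted_wrt (\<ge>) a \<and> sum_list a = n}"

definition dominated :: "nat \<Rightarrow> nat list \<Rightarrow> nat list \<Rightarrow> bool" where
  "dominated n a b \<longleftrightarrow> (\<forall>j\<in>{1..n}. (\<Sum>i<j. a ! i) \<le> (\<Sum>i<j. b ! i))"

definition dominance_lattice :: "nat \<Rightarrow> nat list gorder" where
  "dominance_lattice n = \<lparr>carrier = partitions n, eq = (=), le = dominated n\<rparr>"

text \<open>\<open>padded n xs\<close> is the partition written \<open>xs\<close> when trailing zeros are omitted.\<close>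

definition padded :: "nat \<Rightarrow> nat list \<Rightarrow> nat list" where
  "padded n xs = xs @ replicate (n - length xs) 0"


section \<open>Irreducible elements and arrow relations\<close>

definition join_irreducibles :: "('a, 'b) gorder_scheme \<Rightarrow> 'a set" where
  "join_irreducibles L = {x \<in> carrier L. \<not> least L x (carrier L) \<and>
     (\<forall>y\<in>carrier L. \<forall>z\<in>carrier L. x = y \<squnion>\<^bsub>L\<^esub> z \<longrightarrow> x = y \<or> x = z)}"

definition meet_irreducibles :: "('a, 'b) gorder_scheme \<Rightarrow> 'a set" where
  "meet_irreducibles L = {x \<in> carrier L. \<not> greatest L x (carrier L) \<and>
     (\<forall>y\<in>carrier L. \<forall>z\<in>carrier L. x = y \<sqinter>\<^bsub>L\<^esub> z \<longrightarrow> x = y \<or> x = z)}"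

text \<open>The derivations \<open>g'\<close> of an object and \<open>m'\<close> of an attribute in the standard context
  \<open>(join_irreducibles L, meet_irreducibles L, \<le>)\<close>. The arrow relations are meant for
  \<open>g \<in> join_irreducibles L\<close> and \<open>m \<in> meet_irreducibles L\<close> only.\<close>

definition obj_deriv :: "('a, 'b) gorder_scheme \<Rightarrow> 'a \<Rightarrow> 'a set" where
  "obj_deriv L g = {y \<in> meet_irreducibles L. g \<sqsubseteq>\<^bsub>L\<^esub> y}"

definition attr_deriv :: "('a, 'b) gorder_scheme \<Rightarrow> 'a \<Rightarrow> 'a set" where
  "attr_deriv L m = {y \<in> join_irreducibles L. y \<sqsubseteq>\<^bsub>L\<^esub> m}"

definition down_arrow :: "('a, 'b) gorder_scheme \<Rightarrow> 'a \<Rightarrow> 'a \<Rightarrow> bool" where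
  "down_arrow L g m \<longleftrightarrow> \<not> g \<sqsubseteq>\<^bsub>L\<^esub> m \<and>
     (\<forall>h\<in>join_irreducibles L. obj_deriv L g \<subset> obj_deriv L h \<longrightarrow> h \<sqsubseteq>\<^bsub>L\<^esub> m)"

definition up_arrow :: "('a, 'b) gorder_scheme \<Rightarrow> 'a \<Rightarrow> 'a \<Rightarrow> bool" where
  "up_arrow L g m \<longleftrightarrow> \<not> g \<sqsubseteq>\<^bsub>L\<^esub> m \<and>
     (\<forall>y\<in>meet_irreducibles L. attr_deriv L m \<subset> attr_deriv L y \<longrightarrow> g \<sqsubseteq>\<^bsub>L\<^esub> y)"


section \<open>Types of partitions\<close>

definition type_D :: "nat \<Rightarrow> nat list \<Rightarrow> bool" where
  "type_D n x \<longleftrightarrow> x \<in> partitions n \<and>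
     (\<exists>k b l d. 3 \<le> k \<and> 1 \<le> l \<and> 1 \<le> d \<and> 2 \<le> b + l \<and>
        x = padded n (replicate b (k + 1) @ replicate l k @ replicate d 1))"

definition type_III :: "nat \<Rightarrow> nat list \<Rightarrow> bool" where
  "type_III n x \<longleftrightarrow> x \<in> partitions n \<and>
     (\<exists>a c. 2 \<le> a \<and> 2 \<le> c \<and> x = padded n (a # replicate c 1))"


section \<open>The dominance order is a complete lattice\<close>

text \<open>The library's \<open>\<squnion>\<close> and \<open>\<sqinter>\<close> are chosen by \<open>SOME\<close>; they are genuine suprema and infima
  here because of the following.\<close>

lemma dominance_lattice_simps [simp]:
  "carrier (dominance_lattice n) = partitions n"
  "le (dominance_lattice n) = dominated n"
  "eq (dominance_lattice n) = (=)"
  by (simp_all add: dominance_lattice_def)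

lemma dominated_iff: "dominated n a b \<longleftrightarrow> (\<forall>j\<le>n. (\<Sum>i<j. a ! i) \<le> (\<Sum>i<j. b ! i))"
proof
  assume d: "dominated n a b"
  show "\<forall>j\<le>n. (\<Sum>i<j. a ! i) \<le> (\<Sum>i<j. b ! i)"
  proof (intro allI impI)
    fix j assume "j \<le> n"
    then show "(\<Sum>i<j. a ! i) \<le> (\<Sum>i<j. b ! i)"
      using d by (cases "j = 0") (auto simp: dominated_def)
  qed
qed (simp add: dominated_def)

lemma partitions_sum:
  assumes "a \<in> partitions n" shows "(\<Sum>i<n. a ! i) = n"
  using assms by (auto simp: partitions_def sum_list_sum_nth atLeast0LessThan)

lemma partitions_antimono:
  assumes "a \<in> partitions n" "Suc i < n" shows "a ! Suc i \<le> a ! i"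
  using assms by (auto simp: partitions_def sorted_wrt_iff_nth_less)

lemma dominated_antisym:
  assumes "a \<in> partitions n" "b \<in> partitions n" "dominated n a b" "dominated n b a"
  shows "a = b"
proof (rule nth_equalityI)
  show "length a = length b" using assms by (simp add: partitions_def)
  fix i assume "i < length a"
  then have i: "i < n" using assms by (simp add: partitions_def)
  have "(\<Sum>i<j. a ! i) = (\<Sum>i<j. b ! i)" if "j \<le> n" for j
    using assms(3,4) that by (meson antisym dominated_iff)
  from this[of i] this[of "Suc i"] i show "a ! i = b ! i" by simp
qed

lemma dominated_refl: "dominated n a a"
  by (simp add: dominated_def)

lemma dominated_trans: "dominated n a b \<Longrightarrow> dominated n b c \<Longrightarrow> dominated n a c"
  unfolding dominated_def by (meson le_trans)

lemma partial_order_dominance: "partial_order (dominance_lattice n)"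
  by unfold_locales (auto intro: dominated_refl dominated_antisym dominated_trans)

lemma partitions_from_concave:
  fixes m :: "nat \<Rightarrow> nat"
  assumes 0: "m 0 = 0" and n: "m n = n"
    and mono: "\<And>i. i < n \<Longrightarrow> m i \<le> m (Suc i)"
    and concave: "\<And>i. Suc i < n \<Longrightarrow> m (Suc (Suc i)) + m i \<le> 2 * m (Suc i)"
  obtains a where "a \<in> partitions n" "\<And>j. j \<le> n \<Longrightarrow> (\<Sum>i<j. a ! i) = m j"
proof
  let ?a = "map (\<lambda>i. m (Suc i) - m i) [0..<n]"
  show s: "(\<Sum>i<j. ?a ! i) = m j" if "j \<le> n" for j
    using that by (induction j) (auto simp: 0 mono)
  have "sorted_wrt (\<ge>) ?a"
  proof (subst sorted_wrt_iff_nth_Suc_transp)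
    show "transp ((\<ge>) :: nat \<Rightarrow> nat \<Rightarrow> bool)" by (auto intro: transpI)
    show "\<forall>i. Suc i < length ?a \<longrightarrow> ?a ! Suc i \<le> ?a ! i"
    proof (intro allI impI)
      fix i assume "Suc i < length ?a"
      then have "Suc i < n" by simp
      then show "?a ! Suc i \<le> ?a ! i"
        using concave[of i] mono[of i] mono[of "Suc i"] by simp
    qed
  qed
  moreover have "sum_list ?a = n"
  proof -
    have "sum_list ?a = (\<Sum>i<n. ?a ! i)"
      by (simp only: sum_list_sum_nth atLeast0LessThan length_map length_upt diff_zero)
    then show ?thesis using s[of n] n by simp
  qed
  ultimately show "?a \<in> partitions n" by (simp add: partitions_def)
qed

theorem complete_lattice_dominance: "complete_lattice (dominance_lattice n)"
proof (rule partial_order.complete_lattice_criterion1[OF partial_order_dominance])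
  let ?L = "dominance_lattice n"
  obtain a where a: "a \<in> partitions n" "\<And>j. j \<le> n \<Longrightarrow> (\<Sum>i<j. a ! i) = (if j = 0 then 0 else n)"
    by (rule partitions_from_concave[of "\<lambda>j. if j = 0 then 0 else n" n]) auto
  have "dominated n b a" if b: "b \<in> partitions n" for b
  proof -
    have "(\<Sum>i<j. b ! i) \<le> (\<Sum>i<n. b ! i)" if "j \<le> n" for j
      using that by (intro sum_mono2) auto
    then show ?thesis
      using a(2) partitions_sum[OF b] by (auto simp: dominated_def)
  qed
  then show "\<exists>g. greatest ?L g (carrier ?L)"
    using a(1) by (auto simp: greatest_def)
next
  let ?L = "dominance_lattice n"
  let ?s = "\<lambda>a j. \<Sum>i<j. (a::nat list) ! i"
  fix A assume "A \<subseteq> carrier ?L" and ne: "A \<noteq> {}"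
  then have A: "A \<subseteq> partitions n" by simp
  define m where "m j = Inf ((\<lambda>a. ?s a j) ` A)" for j
  have lower: "m j \<le> ?s a j" if "a \<in> A" for a j
    unfolding m_def using that by (intro cINF_lower) auto
  have attained: "\<exists>a\<in>A. m j = ?s a j" for j
    using Inf_nat_def1[of "(\<lambda>a. ?s a j) ` A"] ne by (auto simp: m_def)
  have zero: "m 0 = 0" using attained[of 0] by auto
  have total: "m n = n" using attained[of n] A partitions_sum by auto
  have mono: "m i \<le> m (Suc i)" for i
  proof -
    obtain a where a: "a \<in> A" "m (Suc i) = ?s a (Suc i)" using attained by blast
    then show ?thesis using lower[of a i] by simp
  qed
  have concave: "m (Suc (Suc i)) + m i \<le> 2 * m (Suc i)" if "Suc i < n" for i
  proof -
    obtain a where a: "a \<in> A" "m (Suc i) = ?s a (Suc i)" using attained by blast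
    have "a ! Suc i \<le> a ! i" using a A that partitions_antimono by blast
    then show ?thesis
      using a lower[of a i] lower[of a "Suc (Suc i)"] by simp
  qed
  obtain c where c: "c \<in> partitions n" "\<And>j. j \<le> n \<Longrightarrow> ?s c j = m j"
    using partitions_from_concave[of m n] zero total mono concave by blast
  have "greatest ?L c (Lower ?L A)"
  proof -
    have "dominated n c a" if "a \<in> A" for a
      using c lower that by (auto simp: dominated_def)
    moreover have "dominated n b c" if "\<And>a. a \<in> A \<Longrightarrow> dominated n b a" for b
      unfolding dominated_iff using c attained that dominated_iff by metis
    ultimately show ?thesis
      using c(1) A unfolding greatest_def Lower_def by (simp add: subset_iff)
  qed
  then show "\<exists>i. greatest ?L i (Lower ?L A)" by blast
qed

end

theory Submission
  imports Defs
begin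

text \<open>A partition \<open>y\<close> satisfies \<open>\<not> y \<le> q\<close> iff it has at most \<open>k - 1\<close> nonzero parts, and \<open>p\<close> lies
  below every \<open>y > q\<close>. As \<open>\<not> p \<le> q\<close>, this gives both that \<open>q\<close> is meet-irreducible and the
  relation \<open>\<nearrow>\<close>; since \<open>q\<close> is also join-irreducible, \<open>q' \<subset> y'\<close> forces \<open>q < y\<close>.

  The partition \<open>h\<close> of \<open>n\<close> into \<open>k - 1\<close> parts that are as equal as possible is the least one not
  below \<open>q\<close>, hence it is join-irreducible. Moreover \<open>h < p\<close>, and so \<open>h\<close> refutes \<open>\<swarrow>\<close>.\<close>

section \<open>Irreducible elements in lattices\<close>

text \<open>If \<open>x\<close> were the join of two elements other than \<open>x\<close>, both
  would lie below \<open>w\<close>, and so would \<open>x\<close>. The witness \<open>w\<close> need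
  not lie below \<open>x\<close>, so \<open>q\<close> can serve as one later.\<close>

lemma join_irreducibleI:
  assumes "lattice L" "x \<in> carrier L" "w \<in> carrier L" "\<not> x \<sqsubseteq>\<^bsub>L\<^esub> w"
    and below: "\<And>y. y \<in> carrier L \<Longrightarrow> y \<sqsubseteq>\<^bsub>L\<^esub> x \<Longrightarrow> y \<noteq> x \<Longrightarrow> y \<sqsubseteq>\<^bsub>L\<^esub> w"
  shows "x \<in> join_irreducibles L"
proof -
  interpret lattice L by fact
  have "x = y \<or> x = z" if "y \<in> carrier L" "z \<in> carrier L" "x = y \<squnion>\<^bsub>L\<^esub> z" for y z
    using that assms(3,4) below join_left[of y z] join_right[of y z] join_le[of y w z] by metis
  moreover have "\<not> least L x (carrier L)"
    using assms(3,4) by (auto simp: least_def)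
  ultimately show ?thesis
    using assms(2) unfolding join_irreducibles_def by blast
qed

lemma meet_irreducibleI:
  assumes "lattice L" "x \<in> carrier L" "w \<in> carrier L" "\<not> w \<sqsubseteq>\<^bsub>L\<^esub> x"
    and above: "\<And>y. y \<in> carrier L \<Longrightarrow> x \<sqsubseteq>\<^bsub>L\<^esub> y \<Longrightarrow> y \<noteq> x \<Longrightarrow> w \<sqsubseteq>\<^bsub>L\<^esub> y"
  shows "x \<in> meet_irreducibles L"
proof -
  interpret lattice L by fact
  have "x = y \<or> x = z" if "y \<in> carrier L" "z \<in> carrier L" "x = y \<sqinter>\<^bsub>L\<^esub> z" for y z
    using that assms(3,4) above meet_left[of y z] meet_right[of y z] meet_le[of w y z] by metis
  moreover have "\<not> greatest L x (carrier L)"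
    using assms(3,4) by (auto simp: greatest_def)
  ultimately show ?thesis
    using assms(2) unfolding meet_irreducibles_def by blast
qed

text \<open>Take \<open>m\<close> maximal among the elements above \<open>y\<close> but not above
  \<open>x\<close>. Everything strictly above \<open>m\<close> is then above \<open>x\<close>, so
  \<open>x\<close> witnesses that \<open>m\<close> is meet-irreducible.\<close>

lemma meet_irreducible_separation:
  assumes "lattice L" "finite (carrier L)"
    and x: "x \<in> carrier L" and y: "y \<in> carrier L" and xy: "\<not> x \<sqsubseteq>\<^bsub>L\<^esub> y"
  obtains m where "m \<in> meet_irreducibles L" "y \<sqsubseteq>\<^bsub>L\<^esub> m" "\<not> x \<sqsubseteq>\<^bsub>L\<^esub> m"
proof -
  interpret lattice L by fact
  let ?A = "{m \<in> carrier L. y \<sqsubseteq>\<^bsub>L\<^esub> m \<and> \<not> x \<sqsubseteq>\<^bsub>L\<^esub> m}"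
  let ?R = "\<lambda>u v. u \<sqsubseteq>\<^bsub>L\<^esub> v \<and> u \<noteq> v"
  have "asymp_on ?A ?R"
    by (rule asymp_onI) (auto dest: le_antisym)
  moreover have "transp_on ?A ?R"
  proof (rule transp_onI)
    fix u v w assume "u \<in> ?A" "v \<in> ?A" "w \<in> ?A" "?R u v" "?R v w"
    then show "?R u w" using le_trans[of u v w] le_antisym[of u v] by auto
  qed
  ultimately have "\<exists>m\<in>?A. \<forall>u\<in>?A. u \<noteq> m \<longrightarrow> \<not> ?R m u"
    using assms(2) xy y by (intro Finite_Set.bex_max_element) auto
  then obtain m where "m \<in> ?A" and max: "\<forall>u\<in>?A. u \<noteq> m \<longrightarrow> \<not> ?R m u" ..
  then have m: "m \<in> carrier L" "y \<sqsubseteq>\<^bsub>L\<^esub> m" "\<not> x \<sqsubseteq>\<^bsub>L\<^esub> m" by simp_all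
  have "x \<sqsubseteq>\<^bsub>L\<^esub> u" if "u \<in> carrier L" "m \<sqsubseteq>\<^bsub>L\<^esub> u" "u \<noteq> m" for u
    using max that le_trans[OF m(2) that(2) y m(1) that(1)] by auto
  then have "m \<in> meet_irreducibles L"
    by (rule meet_irreducibleI[OF assms(1) m(1) x m(3)])
  then show thesis using m(2,3) by (rule that)
qed

lemma lattice_dominance: "lattice (dominance_lattice n)"
proof -
  interpret complete_lattice "dominance_lattice n" by (rule complete_lattice_dominance)
  show ?thesis by (rule lattice_axioms)
qed

lemma finite_partitions: "finite (partitions n)"
proof (rule finite_subset)
  show "partitions n \<subseteq> {xs. set xs \<subseteq> {..n} \<and> length xs = n}"
    using member_le_sum_list by (fastforce simp: partitions_def)
qed (simp add: finite_lists_length_eq)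

section \<open>Partial sums of partitions\<close>

lemma partitions_nth_mono:
  assumes "y \<in> partitions n" "i \<le> j" "j < n" shows "y ! j \<le> y ! i"
  using assms by (cases "i = j") (auto simp: partitions_def sorted_wrt_iff_nth_less)

lemma partial_sum_upper:
  assumes y: "y \<in> partitions n" and "i \<le> j" "j \<le> n"
  shows "(\<Sum>l<j. y ! l) \<le> (\<Sum>l<i. y ! l) + (j - i) * y ! i"
  using assms(2,3)
proof (induction j rule: dec_induct)
  case (step j)
  then show ?case using partitions_nth_mono[OF y, of i j] by (simp add: Suc_diff_le)
qed simp

lemma partial_sum_lower:
  assumes y: "y \<in> partitions n" and "i \<le> j" "j \<le> Suc l" "l < n"
  shows "(\<Sum>u<i. y ! u) + (j - i) * y ! l \<le> (\<Sum>u<j. y ! u)"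
  using assms(2,3)
proof (induction j rule: dec_induct)
  case (step j)
  then show ?case using partitions_nth_mono[OF y, of j l] assms(4) by (simp add: Suc_diff_le)
qed simp

lemma partial_sum_le:
  assumes "y \<in> partitions n" "j \<le> n" shows "(\<Sum>u<j. y ! u) \<le> n"
proof -
  have "(\<Sum>u<j. y ! u) \<le> (\<Sum>u<n. y ! u)" using assms by (intro sum_mono2) auto
  then show ?thesis using partitions_sum[OF assms(1)] by simp
qed

text \<open>Once an entry vanishes, all later ones do, so the total is already reached.\<close>

lemma partial_sum_total_or_positive:
  assumes y: "y \<in> partitions n" and "l < n"
  shows "(\<Sum>u<l. y ! u) = n \<or> 1 \<le> y ! l"
  using partial_sum_upper[OF y, of l n] partial_sum_le[OF y, of l] partitions_sum[OF y] assms(2)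
  by (cases "y ! l") auto

text \<open>If \<open>y ! j \<le> a\<close>, the entries from \<open>j\<close> to
  \<open>t - 1\<close> take at most \<open>(t - j) * a\<close>, which leaves at least
  \<open>a * j + r\<close> for the first \<open>j\<close>. Otherwise each of the first
  \<open>j\<close> entries is at least \<open>a + 1\<close>.\<close>

lemma partial_sum_balanced:
  assumes y: "y \<in> partitions n" and "j \<le> t" "t \<le> n" "r \<le> t" "(\<Sum>l<t. y ! l) = a * t + r"
  shows "a * j + min j r \<le> (\<Sum>l<j. y ! l)"
proof (cases "j = t")
  case False
  then have j: "j < t" "j < n" using assms by auto
  show ?thesis
  proof (cases "y ! j \<le> a")
    case True
    have "a * t + r \<le> (\<Sum>l<j. y ! l) + (t - j) * y ! j"
      using partial_sum_upper[OF y, of j t] assms by simp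
    also have "\<dots> \<le> (\<Sum>l<j. y ! l) + (t - j) * a" using True by simp
    finally have "a * t + r \<le> (\<Sum>l<j. y ! l) + (t - j) * a" .
    moreover have "a * t = a * j + (t - j) * a"
      using le_add_diff_inverse[of j t] j by (metis add_mult_distrib2 less_imp_le mult.commute)
    ultimately show ?thesis by linarith
  next
    case False
    have "j * Suc a \<le> j * y ! j" using False by (intro mult_le_mono2) simp
    then have "j * Suc a \<le> (\<Sum>l<j. y ! l)" using partial_sum_lower[OF y, of 0 j j] j by simp
    then show ?thesis by (simp add: mult.commute)
  qed
qed (use assms in simp)

text \<open>The witness for join-irreducibility moves one unit from position \<open>l\<close> to position \<open>Suc l\<close>.\<close>

lemma join_irreducible_cliff:
  assumes x: "x \<in> partitions n" and l: "Suc l < n" and cliff: "x ! Suc l + 2 \<le> x ! l"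
    and uniq: "\<And>y. y \<in> partitions n \<Longrightarrow> dominated n y x \<Longrightarrow>
      (\<Sum>i<Suc l. y ! i) = (\<Sum>i<Suc l. x ! i) \<Longrightarrow> y = x"
  shows "x \<in> join_irreducibles (dominance_lattice n)"
proof -
  define m where "m j = (\<Sum>i<j. x ! i) - (if j = Suc l then 1 else 0)" for j
  have 0: "m 0 = 0" by (simp add: m_def)
  have 1: "m n = n" using partitions_sum[OF x] l by (simp add: m_def)
  have 2: "m i \<le> m (Suc i)" for i using cliff by (auto simp: m_def)
  \<comment> \<open>Only \<open>i = l\<close> is critical: the lowered sum costs 2 on the right,
    which the cliff pays for. At the neighbouring places the change helps.\<close>
  have 3: "m (Suc (Suc i)) + m i \<le> 2 * m (Suc i)" if "Suc i < n" for i
    using cliff partitions_antimono[OF x that] by (auto simp: m_def)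
  obtain w where w: "w \<in> partitions n" "\<And>j. j \<le> n \<Longrightarrow> (\<Sum>i<j. w ! i) = m j"
    using partitions_from_concave[of m n] 0 1 2 3 by blast
  have "\<not> dominated n x w"
  proof
    assume "dominated n x w"
    then have "(\<Sum>i<Suc l. x ! i) \<le> m (Suc l)" using w(2)[of "Suc l"] l
      unfolding dominated_iff by (metis less_imp_le)
    then show False using cliff by (simp add: m_def)
  qed
  moreover have "dominated n y w" if y: "y \<in> partitions n" "dominated n y x" "y \<noteq> x" for y
    unfolding dominated_iff
  proof (intro allI impI)
    fix j assume j: "j \<le> n"
    have "(\<Sum>i<j. y ! i) \<le> (\<Sum>i<j. x ! i)" using y(2) j by (simp add: dominated_iff)
    \<comment> \<open>The sums of \<open>w\<close> and \<open>x\<close> differ only at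
      \<open>Suc l\<close>, by one; there \<open>uniq\<close> makes the sum of \<open>y\<close>
      strictly smaller than that of \<open>x\<close>.\<close>
    moreover have "(\<Sum>i<Suc l. y ! i) \<noteq> (\<Sum>i<Suc l. x ! i)" using uniq y by blast
    ultimately have "(\<Sum>i<j. y ! i) \<le> m j" by (cases "j = Suc l") (auto simp: m_def)
    then show "(\<Sum>i<j. y ! i) \<le> (\<Sum>i<j. w ! i)" using w(2) j by simp
  qed
  ultimately show ?thesis
    using join_irreducibleI[OF lattice_dominance, of x n w] x w(1) by simp
qed

section \<open>Balanced parts followed by ones\<close>

text \<open>One family covers all three partitions: \<open>p\<close>, then \<open>q\<close> with
  \<open>t = 1\<close> and \<open>r = 0\<close>, and \<open>h\<close> with
  \<open>s = 0\<close>.\<close>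

definition balanced_ones :: "nat \<Rightarrow> nat \<Rightarrow> nat \<Rightarrow> nat \<Rightarrow> nat \<Rightarrow> nat list" where
  "balanced_ones n a t r s =
     padded n (replicate r (a + 1) @ replicate (t - r) a @ replicate s 1)"

context
  fixes n a t r s :: nat
  assumes a: "1 \<le> a" and r: "r \<le> t" and n: "n = a * t + r + s"
begin

text \<open>This keeps the subtraction in \<open>padded\<close> from being truncated.\<close>

lemma balanced_ones_length_le: "t + s \<le> n"
proof -
  have "1 * t \<le> a * t" using a by (rule mult_le_mono1)
  then show ?thesis using n by linarith
qed

lemma balanced_ones_nth:
  "i < n \<Longrightarrow> balanced_ones n a t r s ! i =
    (if i < r then a + 1 else if i < t then a else if i < t + s then 1 else 0)"
  using r balanced_ones_length_le by (auto simp: balanced_ones_def padded_def nth_append)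

lemma balanced_ones_partial_sum:
  "j \<le> n \<Longrightarrow> (\<Sum>i<j. balanced_ones n a t r s ! i) =
    (if j \<le> t then a * j + min j r else min n (a * t + r + (j - t)))"
proof (induction j)
  case (Suc j)
  consider "j < t" | "j = t" | "t < j" by linarith
  then show ?case
  proof cases
    case 3
    then show ?thesis using Suc n r balanced_ones_nth[of j] by auto
  qed (use Suc n r balanced_ones_nth[of j] in auto)
qed simp

lemma balanced_ones_partition: "balanced_ones n a t r s \<in> partitions n"
proof -
  let ?x = "balanced_ones n a t r s"
  have len: "length ?x = n"
    using balanced_ones_length_le r by (simp add: balanced_ones_def padded_def)
  have "sum_list ?x = n"
  proof -
    have "sum_list ?x = r * (a + 1) + (t - r) * a + s"
      by (simp add: balanced_ones_def padded_def sum_list_replicate)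
    also have "(t - r) * a + r * a = t * a" using r by (simp flip: add_mult_distrib)
    then have "r * (a + 1) + (t - r) * a + s = n" using n by (simp add: algebra_simps)
    finally show ?thesis .
  qed
  moreover have "sorted_wrt (\<ge>) ?x"
    using a r by (auto simp: sorted_wrt_iff_nth_less balanced_ones_nth len)
  ultimately show ?thesis using len by (simp add: partitions_def)
qed

text \<open>Up to \<open>t\<close>, equal distribution minimizes partial sums. Beyond
  \<open>t\<close>, \<open>y\<close> gains at least one unit per position until the total
  \<open>n\<close> is reached, and the balanced partition gains exactly one.\<close>

lemma balanced_ones_dominated:
  assumes y: "y \<in> partitions n" and eq: "(\<Sum>i<t. y ! i) = a * t + r"
  shows "dominated n (balanced_ones n a t r s) y"
  unfolding dominated_iff
proof (intro allI impI)
  fix j assume j: "j \<le> n"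
  have tn: "t \<le> n" using balanced_ones_length_le by simp
  show "(\<Sum>i<j. balanced_ones n a t r s ! i) \<le> (\<Sum>i<j. y ! i)"
  proof (cases "j \<le> t")
    case True
    then show ?thesis
      using partial_sum_balanced[OF y True tn r eq] balanced_ones_partial_sum[OF j] by simp
  next
    case False
    then obtain l where l: "j = Suc l" "t \<le> l" by (cases j) auto
    have "n \<le> (\<Sum>i<j. y ! i) \<or> 1 \<le> y ! l"
      using partial_sum_total_or_positive[OF y, of l] l j by auto
    moreover have "a * t + r + (j - t) * y ! l \<le> (\<Sum>i<j. y ! i)"
      using partial_sum_lower[OF y, of t j l] eq l j by simp
    ultimately have "n \<le> (\<Sum>i<j. y ! i) \<or> a * t + r + (j - t) \<le> (\<Sum>i<j. y ! i)"
      by (cases "y ! l") auto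
    then show ?thesis using balanced_ones_partial_sum[OF j] False by auto
  qed
qed

text \<open>The cliff lies after the first \<open>t\<close> entries: the last of them is
  \<open>a \<ge> 3\<close>, the next entry is at most 1. Uniqueness is
  \<open>balanced_ones_dominated\<close> with antisymmetry.\<close>

lemma balanced_ones_join_irreducible:
  assumes "3 \<le> a" "r < t" "t < n"
  shows "balanced_ones n a t r s \<in> join_irreducibles (dominance_lattice n)"
proof -
  obtain l where l: "t = Suc l" using assms(2) by (cases t) auto
  have sum_t: "(\<Sum>i<t. balanced_ones n a t r s ! i) = a * t + r"
    using balanced_ones_partial_sum[of t] assms by simp
  show ?thesis
  proof (rule join_irreducible_cliff[of _ _ l])
    show "Suc l < n" using l assms by simp
    show "balanced_ones n a t r s ! Suc l + 2 \<le> balanced_ones n a t r s ! l"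
      using balanced_ones_nth[of l] balanced_ones_nth[of t] assms l by auto
    fix y assume y: "y \<in> partitions n" "dominated n y (balanced_ones n a t r s)"
      "(\<Sum>i<Suc l. y ! i) = (\<Sum>i<Suc l. balanced_ones n a t r s ! i)"
    then have "dominated n (balanced_ones n a t r s) y"
      using balanced_ones_dominated[of y] sum_t l by simp
    then show "y = balanced_ones n a t r s"
      using dominated_antisym balanced_ones_partition y by blast
  qed (rule balanced_ones_partition)
qed

end

section \<open>The arrow relations\<close>

theorem corollary5p5:
  fixes k d t n c r \<kappa> :: nat and p q :: "nat list"
  assumes "0 < k" and "0 < d" and "0 < t"
    and "4 \<le> k" and "2 \<le> t" and "t \<le> k - 2" and "2 * t \<le> d + 1"
    and "n = k + d"
    and "n - (k - 1) = c * t + r" and "r < t"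
    and "\<kappa> = c + 1"
    and "p = padded n (replicate r (\<kappa> + 1) @ replicate (t - r) \<kappa> @ replicate (k - 1 - t) 1)"
    and "q = padded n ((d + 1) # replicate (k - 1) 1)"
  shows "2 \<le> c \<and>
    p \<in> join_irreducibles (dominance_lattice n) \<and> type_D n p \<and>
    q \<in> meet_irreducibles (dominance_lattice n) \<and> type_III n q \<and>
    up_arrow (dominance_lattice n) p q \<and> \<not> down_arrow (dominance_lattice n) p q"
proof -
  let ?L = "dominance_lattice n"
  have d1: "d + 1 = c * t + r" using assms(1,8,9) by simp
  \<comment> \<open>Otherwise \<open>d + 1 \<le> t + r < 2 * t\<close>.\<close>
  have c: "2 \<le> c"
  proof (rule ccontr)
    assume "\<not> 2 \<le> c"
    then have "c * t \<le> 1 * t" by (intro mult_le_mono1) simp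
    then show False using d1 assms(7,10) by linarith
  qed
  have ct: "2 * c \<le> c * t" using assms(5) by simp

  have p_eq: "p = balanced_ones n \<kappa> t r (k - 1 - t)" using assms by (simp add: balanced_ones_def)
  \<comment> \<open>\<open>p\<close> gives one unit to each of the first \<open>k - 1\<close>
    positions and spreads the remaining \<open>d + 1 = c * t + r\<close> units evenly over the first
    \<open>t\<close>.\<close>
  have p_hyps: "1 \<le> \<kappa>" "r \<le> t" "n = \<kappa> * t + r + (k - 1 - t)" using assms d1 by auto
  have q_eq: "q = balanced_ones n (d + 1) 1 0 (k - 1)" using assms by (simp add: balanced_ones_def)
  have q_hyps: "1 \<le> d + 1" "0 \<le> (1::nat)" "n = (d + 1) * 1 + 0 + (k - 1)" using assms by auto
  note p_part = balanced_ones_partition[OF p_hyps, folded p_eq]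
  note q_part = balanced_ones_partition[OF q_hyps, folded q_eq]
  note p_sum = balanced_ones_partial_sum[OF p_hyps, folded p_eq]
  note q_sum = balanced_ones_partial_sum[OF q_hyps, folded q_eq]

  have p_join: "p \<in> join_irreducibles ?L"
    unfolding p_eq using assms c by (intro balanced_ones_join_irreducible[OF p_hyps]) auto
  have q_join: "q \<in> join_irreducibles ?L"
    unfolding q_eq using assms by (intro balanced_ones_join_irreducible[OF q_hyps]) auto

  have not_dominated_q: "\<not> dominated n y q \<longleftrightarrow> (\<Sum>i<k - 1. y ! i) = n"
    if y: "y \<in> partitions n" for y
  proof
    assume "(\<Sum>i<k - 1. y ! i) = n"
    moreover have "(\<Sum>i<k - 1. q ! i) = n - 1" using q_sum[of "k - 1"] assms(4,8) by auto
    ultimately have "(\<Sum>i<k - 1. q ! i) < (\<Sum>i<k - 1. y ! i)" using assms(1,8) by simp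
    moreover have "k - 1 \<le> n" using assms(8) by simp
    ultimately show "\<not> dominated n y q" unfolding dominated_iff by (meson not_le)
  next
    assume nd: "\<not> dominated n y q"
    show "(\<Sum>i<k - 1. y ! i) = n"
    proof (rule ccontr)
      assume "(\<Sum>i<k - 1. y ! i) \<noteq> n"
      then have pos: "1 \<le> y ! (k - 1)"
        using partial_sum_total_or_positive[OF y, of "k - 1"] assms by simp
      have "dominated n y q" unfolding dominated_iff
      proof (intro allI impI)
        fix j assume j: "j \<le> n"
        show "(\<Sum>i<j. y ! i) \<le> (\<Sum>i<j. q ! i)"
        proof (cases "j \<le> k")
          case True
          \<comment> \<open>The entries at positions \<open>j\<close> to \<open>k - 1\<close> are
            positive, which leaves at most \<open>n - (k - j) = d + j\<close> for the first
            \<open>j\<close>. For \<open>j \<ge> 1\<close> this is the partial sum of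
            \<open>q\<close>.\<close>
          have "(k - j) * 1 \<le> (k - j) * y ! (k - 1)" using pos by (intro mult_le_mono2)
          moreover have "k \<le> Suc (k - 1)" "k - 1 < n" using assms(1,8) by auto
          ultimately have "(\<Sum>i<j. y ! i) + (k - j) \<le> (\<Sum>i<k. y ! i)"
            using partial_sum_lower[OF y, of j k "k - 1"] True by linarith
          then have le: "(\<Sum>i<j. y ! i) + (k - j) \<le> n"
            using partial_sum_le[OF y, of k] assms by simp
          consider "j = 0" | "j = 1" | "1 < j" by linarith
          then show ?thesis
          proof cases
            case 3
            then have "(\<Sum>i<j. q ! i) = min n (d + 1 + (j - 1))" using q_sum[OF j] by simp
            then show ?thesis using 3 le True assms(8) by simp
          qed (use q_sum[OF j] le assms(8) in auto)
        next
          case False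
          then show ?thesis using q_sum[OF j] partial_sum_le[OF y j] assms(1,8) by auto
        qed
      qed
      with nd show False ..
    qed
  qed

  have p_total: "(\<Sum>i<k - 1. p ! i) = n"
    using p_sum[of "k - 1"] p_hyps(3) assms by auto
  have p_not_q: "\<not> dominated n p q" using not_dominated_q[OF p_part] p_total by simp

  have p_below: "dominated n p y" if y: "y \<in> partitions n" "dominated n q y" "y \<noteq> q" for y
    unfolding dominated_iff
  proof (intro allI impI)
    fix j assume j: "j \<le> n"
    have "\<not> dominated n y q" using dominated_antisym[OF y(1) q_part] y by blast
    then have total: "(\<Sum>i<k - 1. y ! i) = n" using not_dominated_q y by simp
    have y1: "d + 1 \<le> (\<Sum>i<1. y ! i)"
    proof -
      have "1 \<le> n" using assms(1,8) by simp
      then have "(\<Sum>i<1. q ! i) \<le> (\<Sum>i<1. y ! i)" using y(2) unfolding dominated_iff by blast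
      then show ?thesis using q_sum[OF \<open>1 \<le> n\<close>] by simp
    qed
    \<comment> \<open>In the middle range, \<open>d + 1 + j\<close> separates the two partial sums.
      From \<open>k - 1\<close> on, \<open>y\<close> has reached its total.\<close>
    consider "j = 0" | "j = 1" | "2 \<le> j" "j < k - 1" | "k - 1 \<le> j" by linarith
    then show "(\<Sum>i<j. p ! i) \<le> (\<Sum>i<j. y ! i)"
    proof cases
      case 2
      have "(\<Sum>i<1. p ! i) = \<kappa> + min 1 r" using p_sum[of 1] assms by simp
      also have "\<dots> \<le> d + 1" using ct c d1 assms(11) by linarith
      finally show ?thesis using 2 y1 by simp
    next
      case 3
      have "1 \<le> p ! (k - 2)"
        using balanced_ones_nth[OF p_hyps, folded p_eq, of "k - 2"] assms by auto
      then have "(k - 1 - j) * 1 \<le> (k - 1 - j) * p ! (k - 2)" by (intro mult_le_mono2)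
      moreover have "k - 1 \<le> Suc (k - 2)" "k - 2 < n" using assms(4,8) by auto
      ultimately have "(\<Sum>i<j. p ! i) + (k - 1 - j) \<le> n"
        using partial_sum_lower[OF p_part, of j "k - 1" "k - 2"] 3 p_total by linarith
      \<comment> \<open>The bound is \<open>n - (k - 1 - j)\<close>, since positions
        \<open>j\<close> to \<open>k - 2\<close> of \<open>p\<close> hold at least one unit
        each.\<close>
      then have pj: "(\<Sum>i<j. p ! i) \<le> d + 1 + j" using 3 assms by simp
      have "d + 1 + j \<le> (\<Sum>i<j. y ! i)"
      \<comment> \<open>Either positions \<open>j\<close> to \<open>k - 2\<close> of
        \<open>y\<close> hold at most one unit each, or positions 1 to \<open>j - 1\<close> hold at
        least two each. The latter gives \<open>d + 1 + 2 * (j - 1)\<close>, which suffices because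
        \<open>j \<ge> 2\<close>.\<close>
      proof (cases "y ! j \<le> 1")
        case True
        then have "(k - 1 - j) * y ! j \<le> (k - 1 - j) * 1" by (intro mult_le_mono2)
        moreover have "k - 1 \<le> n" using assms(8) by simp
        ultimately show ?thesis
          using partial_sum_upper[OF y(1), of j "k - 1"] 3 total assms(8) by linarith
      next
        case False
        then have "(j - 1) * 2 \<le> (j - 1) * y ! j" by (intro mult_le_mono2) simp
        moreover have "j < n" using 3 assms(8) by simp
        ultimately show ?thesis
          using partial_sum_lower[OF y(1), of 1 j j] 3 y1 by linarith
      qed
      with pj show ?thesis by simp
    next
      case 4
      then have "(\<Sum>i<k - 1. y ! i) \<le> (\<Sum>i<j. y ! i)" by (intro sum_mono2) auto
      then show ?thesis using total partial_sum_le[OF p_part j] by simp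
    qed simp
  qed

  have q_meet: "q \<in> meet_irreducibles ?L"
    using meet_irreducibleI[OF lattice_dominance, of q n p] q_part p_part p_not_q p_below by simp

  have up: "up_arrow ?L p q"
    unfolding up_arrow_def
  proof (intro conjI ballI impI)
    fix y assume "y \<in> meet_irreducibles ?L" and sub: "attr_deriv ?L q \<subset> attr_deriv ?L y"
    then have "y \<in> partitions n" by (simp add: meet_irreducibles_def)
    moreover have "q \<in> attr_deriv ?L q" using q_join by (simp add: attr_deriv_def dominated_refl)
    then have "dominated n q y" using sub by (auto simp: attr_deriv_def)
    moreover have "y \<noteq> q" using sub by blast
    ultimately show "p \<sqsubseteq>\<^bsub>?L\<^esub> y" using p_below by simp
  qed (use p_not_q in simp)

  have down: "\<not> down_arrow ?L p q"
  proof -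
    define h where "h = balanced_ones n (n div (k - 1)) (k - 1) (n mod (k - 1)) 0"
    have h_hyps: "1 \<le> n div (k - 1)" "n mod (k - 1) \<le> k - 1"
      "n = n div (k - 1) * (k - 1) + n mod (k - 1) + 0"
    proof -
      show "1 \<le> n div (k - 1)"
        using assms(4,8) div_greater_zero_iff[of n "k - 1"] by linarith
      show "n mod (k - 1) \<le> k - 1" using assms(4) by (intro less_imp_le mod_less_divisor) simp
    qed (simp only: div_mult_mod_eq add_0_right)
    note h_part = balanced_ones_partition[OF h_hyps, folded h_def]
    have h_least: "dominated n h y" if "y \<in> partitions n" "\<not> dominated n y q" for y
      unfolding h_def using not_dominated_q that
      by (intro balanced_ones_dominated[OF h_hyps that(1)]) (simp only: div_mult_mod_eq)
    have "k - 1 \<le> n" using assms(8) by simp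
    then have "(\<Sum>i<k - 1. h ! i) = n div (k - 1) * (k - 1) + n mod (k - 1)"
      using balanced_ones_partial_sum[OF h_hyps, folded h_def, of "k - 1"] h_hyps(2)
      by (simp only: min_absorb2 le_refl if_True)
    then have h_not_q: "\<not> dominated n h q"
      using not_dominated_q[OF h_part] by (simp only: div_mult_mod_eq)
    \<comment> \<open>The quotient \<open>n div (k - 1)\<close> may be below 3, so
      \<open>balanced_ones_join_irreducible\<close> does not apply. Instead \<open>q\<close> is the
      witness: a \<open>y\<close> below \<open>h\<close> but not below \<open>q\<close> is also
      above \<open>h\<close>, hence equal to it.\<close>
    have h_join: "h \<in> join_irreducibles ?L"
    proof (rule join_irreducibleI[OF lattice_dominance, where w = q])
      fix y assume "y \<in> carrier ?L" "y \<sqsubseteq>\<^bsub>?L\<^esub> h" "y \<noteq> h"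
      then show "y \<sqsubseteq>\<^bsub>?L\<^esub> q" using h_least dominated_antisym h_part by auto
    qed (use h_part q_part h_not_q in simp_all)
    have hp: "dominated n h p" using h_least p_part p_not_q by blast
    \<comment> \<open>Among the first \<open>k - 1\<close> entries, \<open>p\<close> has a gap of at
      least 2, from \<open>\<kappa> \<ge> 3\<close> down to 1, while those of \<open>h\<close>
      differ by at most 1.\<close>
    have "p \<noteq> h"
    proof
      assume "p = h"
      moreover have "3 \<le> p ! 0" "p ! (k - 2) = 1"
        using balanced_ones_nth[OF p_hyps, folded p_eq, of 0]
          balanced_ones_nth[OF p_hyps, folded p_eq, of "k - 2"] assms(3-6,8,10,11) c by auto
      moreover have "h ! 0 \<le> h ! (k - 2) + 1"
        using balanced_ones_nth[OF h_hyps, folded h_def, of 0]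
          balanced_ones_nth[OF h_hyps, folded h_def, of "k - 2"] assms(4,8) by auto
      ultimately show False by simp
    qed
    then have "\<not> dominated n p h" using dominated_antisym h_part p_part hp by blast
    \<comment> \<open>The relation compares derivations, so strictness of \<open>h < p\<close> has
      to be seen by a meet-irreducible element.\<close>
    then obtain m where "m \<in> meet_irreducibles ?L" "dominated n h m" "\<not> dominated n p m"
      using meet_irreducible_separation[OF lattice_dominance, of n p h] finite_partitions p_part h_part
      by auto
    then have "obj_deriv ?L p \<subset> obj_deriv ?L h"
      using dominated_trans[OF hp] by (auto simp: obj_deriv_def)
    then show ?thesis using h_join h_not_q by (auto simp: down_arrow_def)
  qed

  have "3 \<le> \<kappa>" "1 \<le> t - r" "1 \<le> k - 1 - t" "2 \<le> r + (t - r)"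
    using assms(4,5,6,10,11) c by auto
  then have "type_D n p"
    unfolding type_D_def using p_part assms(12) by blast
  moreover have "2 \<le> d + 1" "2 \<le> k - 1" using assms(2,4) by auto
  then have "type_III n q"
    unfolding type_III_def using q_part assms(13) by blast
  ultimately show ?thesis using c p_join q_meet up down by blast
qed

end
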